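(* Let $N > 1$ be an odd integer not divisible by $3$. For each divisor $d > 1$ of $N$ let $k_d = \operatorname{ord}_d(2)$, and let $K_N = \sum_{d \mid N,\, d > 1} \frac{\phi(d)}{k_d}$. Then the determinant of the adjacency matrix $M_N$ of the modular Conway amusical graph satisfies $\det M_N = 0$ if $k_p$ is even for at least one prime $p \mid N$; $\det M_N = 3 \cdot 2^{K_N}$ if $k_p$ is odd for all primes $p \mid N$ and $N \equiv \pm 1, \pm 5 \pmod{24}$; $\det M_N = -3 \cdot 2^{K_N}$ if $k_p$ is odd for all primes $p \mid N$ and $N \equiv \pm 7, \pm 11 \pmod{24}$.
   Context: Conway's amusical function $U : \mathbb{N} \to \mathbb{N}$ is $U(n) = 3n/2$ if $n$ is even, $U(n) = (3n+1)/4$ if $n \equiv 1 \pmod 4$, and $U(n) = (3n-1)/4$ if $n \equiv -1 \pmod 4$. For $N \in \mathbb{N}$ the modular Conway amusical graph has vertex set $\mathbb{Z}_N = \{0,\ldots,N-1\}$ with an edge $a \to b$ iff some $n \in \mathbb{N}$ has $n \equiv a \pmod N$ and $U(n) \equiv b \pmod N$. Its adjacency matrix $M_N = (m_{a,b})$ (rows and columns indexed $0,\ldots,N-1$) has $m_{a,b}$ equal to the number of the three rules (the rule for even $n$, for $n \equiv 1 \pmod 4$, for $n \equiv -1 \pmod 4$) for which some $n \in \mathbb{N}$ with $n \equiv a \pmod N$ satisfying that rule's condition has $U(n) \equiv b \pmod N$; so a double edge gives entry $2$. For odd $N$ coprime to $3$ this means $m_{a,b} = [b \equiv 2^{-1}3a]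 + [b \equiv 4^{-1}(3a+1)] + [b \equiv 4^{-1}(3a-1)]$ modulo $N$. $\operatorname{ord}_d(2)$ is the multiplicative order of $2$ modulo $d$ and $\phi$ is Euler's totient function. *)

theory Defs
  imports "HOL-Number_Theory.Number_Theory" "Jordan_Normal_Form.Determinant"
begin

definition amusical_U :: "nat \<Rightarrow> nat" where
  "amusical_U n =
     (if even n then 3 * n div 2
      else if [n = 1] (mod 4) then (3 * n + 1) div 4
      else (3 * n - 1) div 4)"

text \<open>All divisions in the definition are exact.\<close>

lemma amusical_U_exact:
  "even n \<Longrightarrow> 2 * amusical_U n = 3 * n"
  "[n = 1] (mod 4) \<Longrightarrow> 4 * amusical_U n = 3 * n + 1"
  "[n = 3] (mod 4) \<Longrightarrow> 4 * amusical_U n + 1 = 3 * n"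
  by (simp_all add: amusical_U_def cong_def; presburger)+

definition amusical_edge :: "nat \<Rightarrow> nat \<Rightarrow> nat \<Rightarrow> bool" where
  "amusical_edge N a b \<longleftrightarrow> (\<exists>n. [n = a] (mod N) \<and> [amusical_U n = b] (mod N))"

text \<open>The edges contributed by a single rule, \<open>R\<close> being the condition of that rule.\<close>

definition amusical_rule_edge :: "(nat \<Rightarrow> bool) \<Rightarrow> nat \<Rightarrow> nat \<Rightarrow> nat \<Rightarrow> bool" where
  "amusical_rule_edge R N a b \<longleftrightarrow>
     (\<exists>n. R n \<and> [n = a] (mod N) \<and> [amusical_U n = b] (mod N))"

definition amusical_adj :: "nat \<Rightarrow> int mat" where
  "amusical_adj N = mat N N (\<lambda>(a, b).
     of_bool (amusical_rule_edge (\<lambda>n. even n) N a b) +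
     of_bool (amusical_rule_edge (\<lambda>n. [n = 1] (mod 4)) N a b) +
     of_bool (amusical_rule_edge (\<lambda>n. [n = 3] (mod 4)) N a b))"

lemma amusical_adj_pos_iff_edge:
  assumes "a < N" "b < N"
  shows "amusical_adj N $$ (a, b) > 0 \<longleftrightarrow> amusical_edge N a b"
proof -
  have "even n \<or> [n = 1] (mod 4) \<or> [n = 3] (mod 4)" for n :: nat
    unfolding cong_def by presburger
  then have "amusical_edge N a b \<longleftrightarrow>
      amusical_rule_edge (\<lambda>n. even n) N a b \<or>
      amusical_rule_edge (\<lambda>n. [n = 1] (mod 4)) N a b \<or>
      amusical_rule_edge (\<lambda>n. [n = 3] (mod 4)) N a b"
    unfolding amusical_edge_def amusical_rule_edge_def by blast
  then show ?thesis
    using assms by (auto simp: amusical_adj_def)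
qed

definition amusical_K :: "nat \<Rightarrow> nat" where
  "amusical_K N = (\<Sum>d | d dvd N \<and> d > 1. totient d div ord d 2)"

text \<open>For odd \<open>N\<close> the quotients in the sum are exact.\<close>

lemma ord_2_dvd_totient:
  assumes "odd N" "d dvd N"
  shows "ord d 2 dvd totient d"
proof (rule order_divides_totient)
  have "odd d" using assms by (metis dvd_trans)
  then show "coprime d 2" by simp
qed

end

theory Submission
  imports Defs
begin

text \<open>
  Let \<open>D\<close>, \<open>T\<close> be the operators \<open>f(c) \<mapsto> f(2c)\<close> and \<open>f(c) \<mapsto> f(c + 1/4)\<close> on functions on the residues
  modulo \<open>N\<close>. Substituting \<open>c = 3a/4\<close>, the adjacency matrix is \<open>P A\<close> with \<open>P\<close> the permutation
  \<open>a \<mapsto> 3a/4\<close> and \<open>A = D + T + T\<inverse>\<close>. From \<open>T D = D T\<^sup>2\<close> one gets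
  \<open>(T - T\<inverse>) A = (1 + D) (T\<^sup>2 - T\<^sup>-\<^sup>2)\<close>, and \<open>T - T\<inverse>\<close> is conjugate to \<open>T\<^sup>2 - T\<^sup>-\<^sup>2\<close> by \<open>D\<close>; treating the
  constants, the common kernel, separately yields \<open>2 det A = 3 det (1 + D)\<close>.

  If doubling has an orbit of even length, \<open>1 + D\<close> is singular. Otherwise doubling has odd order,
  and \<open>det (1 + D)\<close> counts the invariant subsets, which gives \<open>2\<close> to the number of orbits. The sign
  of \<open>P\<close> is that of multiplication by \<open>3\<close>, read off from its inversions; likewise, the inversions of
  multiplication by \<open>2\<close>, an even permutation in the odd case, force \<open>N \<equiv> \<plusminus>1 (mod 8)\<close>.
\<close>

subsection \<open>Permutations and determinants\<close>

text \<open>Induction on \<open>n\<close>: deleting the point \<open>n\<close> and its image and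
  closing both gaps keeps the inversions among the smaller indices. The last index has
  \<open>n - p n\<close> inversions, of the same parity as the exponent \<open>n + p n\<close> that
  the insertion contributes to the sign.\<close>

lemma sign_eq_inversions:
  fixes p :: "nat \<Rightarrow> nat" and n :: nat
  assumes "p permutes {0..<n}"
  shows "sign p = (-1) ^ (\<Sum>j<n. card {i. i < j \<and> p j < p i})"
  using assms
proof (induction n arbitrary: p)
  case 0
  then show ?case by simp
next
  case (Suc n)
  define q where "q = permutation_delete p n"
  have q: "q permutes {0..<n}"
    unfolding q_def by (rule permutation_delete_permutes[OF Suc.prems]) simp
  have p_eq: "p = permutation_insert n (p n) q"
    unfolding q_def by (rule permutation_insert_delete[OF Suc.prems, symmetric]) simp
  have pn: "p n \<le> n"
    using permutes_in_image[OF Suc.prems, of n] by simp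
  have p_less: "p i = insert_index (p n) (q i)" if "i < n" for i
  proof -
    have "permutation_insert n (p n) q i = insert_index (p n) (q i)"
      using that by (simp add: permutation_insert_def insert_dom_def insert_ran_def)
    with fun_cong[OF p_eq, of i] show ?thesis by (rule trans)
  qed
  have same: "{i. i < j \<and> p j < p i} = {i. i < j \<and> q j < q i}" if "j < n" for j
  proof -
    have "insert_index k a < insert_index k b \<longleftrightarrow> a < b" for k a b
      by (auto simp: insert_index_def)
    then have "p j < p i \<longleftrightarrow> q j < q i" if "i < j" for i
      using p_less[of i] p_less[of j] \<open>j < n\<close> that by (metis less_trans)
    then show ?thesis by blast
  qed
  \<comment> \<open>Every value above \<open>p n\<close> is attained at an index before
    \<open>n\<close>, so these inversions can be counted by their values.\<close>
  have "p ` {i. i < n \<and> p n < p i} = {p n<..n}"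
  proof (intro equalityI subsetI)
    fix k assume "k \<in> p ` {i. i < n \<and> p n < p i}"
    then obtain i where "k = p i" "i < n" "p n < p i" by blast
    then show "k \<in> {p n<..n}"
      using permutes_in_image[OF Suc.prems, of i] by simp
  next
    fix k assume k: "k \<in> {p n<..n}"
    then have "k \<in> p ` {0..<Suc n}"
      using permutes_image[OF Suc.prems] by auto
    then obtain i where i: "k = p i" "i < Suc n" by auto
    with k have "i \<noteq> n" by auto
    with i k show "k \<in> p ` {i. i < n \<and> p n < p i}" by auto
  qed
  then have "card {i. i < n \<and> p n < p i} = n - p n"
    using card_image[OF permutes_inj_on[OF Suc.prems], of "{i. i < n \<and> p n < p i}"]
    by (metis card_greaterThanAtMost)
  moreover have "sign p = (-1) ^ (n + p n) * sign q"
    using signof_permutation_insert[OF q, of n "p n", where 'a = int] pn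
    unfolding p_eq[symmetric] by simp
  moreover have "(-1 :: int) ^ (n + p n) = (-1) ^ (n - p n)"
    using pn by (simp add: minus_one_power_iff)
  ultimately show ?case
    by (simp add: Suc.IH[OF q] same power_add)
qed

text \<open>The sign is multiplicative, and \<open>-1\<close> has no odd power equal to
  \<open>1\<close>.\<close>

lemma sign_odd_order:
  assumes "p permutes S" "finite S" "odd m" "p ^^ m = id"
  shows "sign p = 1"
proof -
  have perm: "permutation p"
    using assms permutation_permutes by blast
  have "permutation (p ^^ k) \<and> sign (p ^^ k) = sign p ^ k" for k
    by (induction k) (simp_all add: sign_compose perm permutation_compose permutation_id funpow.simps del: o_apply)
  then have "sign p ^ m = 1"
    using assms(4) sign_id by metis
  then show ?thesis
    using \<open>odd m\<close> by (cases p rule: sign_cases) simp_all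
qed

text \<open>Conjugation by the unitriangular \<open>?U\<close> gives the lower triangular
  \<open>?L\<close>, whose only diagonal entry other than \<open>1\<close> is
  \<open>1 + of_nat n * y\<close>.\<close>

lemma det_one_plus_const:
  fixes y :: "'a :: comm_ring_1"
  assumes "n > 0"
  shows "det (mat n n (\<lambda>(i, j). of_bool (i = j) + y)) = 1 + of_nat n * y"
proof -
  let ?M = "mat n n (\<lambda>(i, j). of_bool (i = j) + y)"
  let ?U = "mat n n (\<lambda>(i, j). of_bool (i = 0 \<or> i = j)) :: 'a mat"
  let ?L = "mat n n (\<lambda>(i, j). if j = 0 then if i = 0 then 1 + of_nat n * y else y else of_bool (i = j))"
  have sum_delta: "(\<Sum>k = 0..<n. of_bool (i = k) * f k) = f i" if "i < n" for f :: "nat \<Rightarrow> 'a" and i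
    using that by (simp add: of_bool_def if_distrib[of "\<lambda>x. x * _"] cong: if_cong)
  have "?U * ?M = ?L * ?U"
  proof (rule eq_matI)
    fix i j assume "i < dim_row (?L * ?U)" "j < dim_col (?L * ?U)"
    then have ij: "i < n" "j < n" by simp_all
    have "(?U * ?M) $$ (i, j) = (\<Sum>k = 0..<n. of_bool (i = 0 \<or> i = k) * (of_bool (k = j) + y))"
      using ij by (simp add: scalar_prod_def)
    also have "\<dots> = (if i = 0 then 1 + of_nat n * y else of_bool (i = j) + y)"
      using ij by (cases "i = 0") (simp_all add: sum_delta sum.distrib)
    also have "\<dots> = (\<Sum>k = 0..<n. (if k = 0 then if i = 0 then 1 + of_nat n * y else y else of_bool (i = k))
        * of_bool (k = 0 \<or> k = j))"
    proof -
      have "(\<Sum>k = 0..<n. (if k = 0 then if i = 0 then 1 + of_nat n * y else y else of_bool (i = k))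
        * of_bool (k = 0 \<or> k = j)) = (if i = 0 then 1 + of_nat n * y else y) +
          (\<Sum>k \<in> {0..<n} - {0}. of_bool (i = k) * of_bool (k = j))"
        using assms by (subst sum.remove[of _ 0]) (auto intro!: sum.cong)
      also have "(\<Sum>k \<in> {0..<n} - {0}. of_bool (i = k) * of_bool (k = j)) =
          (\<Sum>k = 0..<n. of_bool (i = k) * (of_bool (k \<noteq> 0 \<and> k = j) :: 'a))"
        by (intro sum.mono_neutral_cong_left) auto
      also have "\<dots> = of_bool (i \<noteq> 0 \<and> i = j)"
        using ij by (simp add: sum_delta)
      finally show ?thesis by simp
    qed
    also have "\<dots> = (?L * ?U) $$ (i, j)"
      using ij by (simp add: scalar_prod_def)
    finally show "(?U * ?M) $$ (i, j) = (?L * ?U) $$ (i, j)" .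
  qed simp_all
  then have "det ?U * det ?M = det ?L * det ?U"
    using det_mult[of ?U n ?M] det_mult[of ?L n ?U] by simp
  moreover have "det ?U = 1"
  proof -
    have "det ?U = prod_list (diag_mat ?U)"
      by (rule det_upper_triangular[of _ n]) (auto simp: upper_triangular_def)
    then show ?thesis by (simp add: prod_list_diag_prod)
  qed
  moreover have "det ?L = 1 + of_nat n * y"
  proof -
    have "det ?L = prod_list (diag_mat ?L)"
      by (rule det_lower_triangular[of n]) auto
    also have "\<dots> = (\<Prod>i = 0..<n. if i = 0 then 1 + of_nat n * y else 1)"
      unfolding prod_list_diag_prod by (rule prod.cong) auto
    also have "\<dots> = 1 + of_nat n * y"
      using assms by (subst prod.delta) simp_all
    finally show ?thesis .
  qed
  ultimately show ?thesis by simp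
qed

lemma det_one_plus_permutation:
  assumes p: "p permutes {0..<n}" and "odd m" and pm: "p ^^ m = id"
  shows "det (mat n n (\<lambda>(i, j). of_bool (j = i) + of_bool (j = p i)) :: 'a :: comm_ring_1 mat) =
    of_nat (card {X. X \<subseteq> {0..<n} \<and> p ` X \<subseteq> X})"
proof -
  let ?A = "{0..<n}"
  txt \<open>Leibniz formula, expanded over the set \<open>X\<close> of rows in which the entry of \<open>p\<close> is chosen: the only
    candidate permutation is \<open>g X\<close>, which is a permutation iff \<open>X\<close> is invariant, and is then even.\<close>
  define g where "g X i = (if i \<in> X then p i else i)" for X i
  have summand: "(\<Sum>q | q permutes ?A. signof q *
      ((\<Prod>i\<in>X. of_bool (q i = p i)) * (\<Prod>i\<in>?A - X. of_bool (q i = i))))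
      = (of_bool (p ` X \<subseteq> X) :: 'a)" if X: "X \<subseteq> ?A" for X
  proof -
    have fin: "finite X" using X finite_subset by blast
    have iff: "(\<forall>i\<in>X. q i = p i) \<and> (\<forall>i\<in>?A - X. q i = i) \<longleftrightarrow> q = g X"
      if "q permutes ?A" for q
      using X permutes_not_in[OF that] by (fastforce simp: g_def fun_eq_iff)
    have "(\<Sum>q | q permutes ?A. signof q *
      ((\<Prod>i\<in>X. of_bool (q i = p i)) * (\<Prod>i\<in>?A - X. of_bool (q i = i))))
      = (\<Sum>q | q permutes ?A. if q = g X then signof q else (0::'a))"
    proof (intro sum.cong refl)
      fix q assume "q \<in> {q. q permutes ?A}"
      then have "q = g X \<longleftrightarrow> (\<forall>i\<in>X. q i = p i) \<and> (\<forall>i\<in>?A - X. q i = i)"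
        using iff by auto
      moreover have "(\<Prod>i\<in>X. of_bool (q i = p i)) = (of_bool (\<forall>i\<in>X. q i = p i) :: 'a)"
        using fin by (induction X) auto
      moreover have "(\<Prod>i\<in>?A - X. of_bool (q i = i)) = (of_bool (\<forall>i\<in>?A - X. q i = i) :: 'a)"
        using finite_Diff[OF finite_atLeastLessThan, of 0 n X]
        by (induction "?A - X" rule: finite_induct) (auto simp: of_bool_def intro!: prod.neutral prod_zero)
      ultimately show "signof q * ((\<Prod>i\<in>X. of_bool (q i = p i)) * (\<Prod>i\<in>?A - X. of_bool (q i = i)))
         = (if q = g X then signof q else (0::'a))"
        by auto
    qed
    also have "\<dots> = (if g X permutes ?A then signof (g X) else 0)"
      by (simp add: finite_permutations)
    also have "\<dots> = of_bool (p ` X \<subseteq> X)"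
    proof (cases "p ` X \<subseteq> X")
      case True
      have "p ` X = X"
        using True fin permutes_inj_on[OF p] by (metis card_image card_subset_eq)
      then have gX: "g X permutes X"
        unfolding g_def using permutes_inj_on[OF p]
        by (intro bij_imp_permutes) (auto simp: bij_betw_def inj_on_def)
      \<comment> \<open>On the invariant set \<open>X\<close> the iterates of \<open>g X\<close> are
        those of \<open>p\<close>, so \<open>g X\<close> inherits the odd exponent \<open>m\<close>
        and is even.\<close>
      have iter: "(g X ^^ k) i = (if i \<in> X then (p ^^ k) i else i) \<and> (i \<in> X \<longrightarrow> (p ^^ k) i \<in> X)" for k i
        using True by (induction k) (auto simp: g_def)
      then have "g X ^^ m = id"
        using pm by (auto simp: fun_eq_iff)
      then have "sign (g X) = 1"
        using sign_odd_order[OF gX fin \<open>odd m\<close>] by simp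
      then show ?thesis
        using True permutes_subset[OF gX X] by simp
    next
      case False
      \<comment> \<open>Where \<open>p\<close> leaves \<open>X\<close>, the value \<open>p i\<close>
        is taken by \<open>g X\<close> both at \<open>i\<close> and at the fixed point
        \<open>p i\<close>.\<close>
      then obtain i where i: "i \<in> X" "p i \<notin> X" by blast
      have "g X (p i) = g X i" using i by (simp add: g_def)
      moreover have "p i \<noteq> i" using i by auto
      ultimately have "\<not> g X permutes ?A"
        by (metis permutes_inj injD)
      then show ?thesis using False by simp
    qed
    finally show ?thesis .
  qed
  have "det (mat n n (\<lambda>(i, j). of_bool (j = i) + of_bool (j = p i)) :: 'a mat) =
      (\<Sum>q | q permutes ?A. signof q * (\<Prod>i = 0..<n. of_bool (q i = p i) + of_bool (q i = i)))"
    by (subst det_def'[of _ n]) (auto intro!: sum.cong prod.cong simp: add.commute)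
  also have "\<dots> = (\<Sum>X\<in>Pow ?A. \<Sum>q | q permutes ?A. signof q *
      ((\<Prod>i\<in>X. of_bool (q i = p i)) * (\<Prod>i\<in>?A - X. of_bool (q i = i))))"
    by (subst sum.swap) (simp add: prod_add sum_distrib_left)
  also have "\<dots> = (\<Sum>X\<in>Pow ?A. of_bool (p ` X \<subseteq> X))"
    by (intro sum.cong refl summand) auto
  also have "\<dots> = of_nat (card {X. X \<subseteq> ?A \<and> p ` X \<subseteq> X})"
    by (simp add: Pow_def Int_def conj_commute)
  finally show ?thesis .
qed

text \<open>A closed set is the union of the classes inside it, so \<open>Union\<close> is a
  bijection from the sets of classes onto the closed sets.\<close>

lemma card_saturated_subsets:
  assumes "equiv A R" "finite A"
  shows "card {X. X \<subseteq> A \<and> R `` X \<subseteq> X} = 2 ^ card (A // R)"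
proof -
  have "bij_betw Union (Pow (A // R)) {X. X \<subseteq> A \<and> R `` X \<subseteq> X}"
  proof (rule bij_betw_byWitness[where f' = "\<lambda>X. {C \<in> A // R. C \<subseteq> X}"])
    show "\<forall>S\<in>Pow (A // R). {C \<in> A // R. C \<subseteq> \<Union> S} = S"
    proof (intro ballI equalityI subsetI)
      fix S C assume S: "S \<in> Pow (A // R)" and C: "C \<in> {C \<in> A // R. C \<subseteq> \<Union> S}"
      then obtain x where "x \<in> C" using in_quotient_imp_non_empty[OF assms(1)] by blast
      then obtain D where "D \<in> S" "x \<in> D" using C by blast
      then have "C = D"
        using quotient_disj[OF assms(1), of C D] C S \<open>x \<in> C\<close> by blast
      then show "C \<in> S" using \<open>D \<in> S\<close> by simp
    qed auto
    show "\<forall>X\<in>{X. X \<subseteq> A \<and> R `` X \<subseteq> X}. \<Union> {C \<in> A // R. C \<subseteq> X} = X"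
    proof (intro ballI equalityI subsetI)
      fix X x assume X: "X \<in> {X. X \<subseteq> A \<and> R `` X \<subseteq> X}" and x: "x \<in> X"
      then have "R `` {x} \<in> A // R" "R `` {x} \<subseteq> X" "x \<in> R `` {x}"
        using equiv_class_self[OF assms(1)] by (auto intro: quotientI)
      then show "x \<in> \<Union> {C \<in> A // R. C \<subseteq> X}" by blast
    qed auto
    show "Union ` Pow (A // R) \<subseteq> {X. X \<subseteq> A \<and> R `` X \<subseteq> X}"
      using in_quotient_imp_subset[OF assms(1)] in_quotient_imp_closed[OF assms(1)] by blast
    show "(\<lambda>X. {C \<in> A // R. C \<subseteq> X}) ` {X. X \<subseteq> A \<and> R `` X \<subseteq> X} \<subseteq> Pow (A // R)"
      by auto
  qed
  then have "card {X. X \<subseteq> A \<and> R `` X \<subseteq> X} = card (Pow (A // R))"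
    by (simp add: bij_betw_same_card)
  then show ?thesis
    using card_Pow[OF finite_quotient[OF assms(2)]] equiv_type[OF assms(1)] by simp
qed

subsection \<open>Multiplication modulo \<open>N\<close> as a permutation\<close>

text \<open>Integer arguments allow negative shifts, while the value is a natural number and can
  index a matrix.\<close>

definition res :: "nat \<Rightarrow> int \<Rightarrow> nat" where
  "res N x = nat (x mod int N)"

lemma res_less [simp]: "N > 0 \<Longrightarrow> res N x < N"
  by (simp add: res_def nat_less_iff)

lemma res_eq_iff: "N > 0 \<Longrightarrow> res N x = res N y \<longleftrightarrow> [x = y] (mod int N)"
  by (simp add: res_def cong_def nat_eq_iff)

lemma res_of_nat: "i < N \<Longrightarrow> res N (int i) = i"
  by (simp add: res_def)

lemma eq_res_iff: "N > 0 \<Longrightarrow> j < N \<Longrightarrow> j = res N x \<longleftrightarrow> [int j = x] (mod int N)"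
  using res_eq_iff[of N "int j" x] res_of_nat[of j N] by simp

lemma res_simps:
  assumes "N > 0"
  shows "res N (int (res N x) + y) = res N (x + y)" "res N (int (res N x) - y) = res N (x - y)"
    "res N (y * int (res N x)) = res N (y * x)"
  using assms by (simp_all add: res_def mod_simps)

text \<open>Serves multiplications (\<open>s = 0\<close>) and shifts (\<open>u = 1\<close>)
  alike.\<close>

lemma bij_betw_res_affine:
  assumes "N > 0" "coprime u (int N)"
  shows "bij_betw (\<lambda>k. res N (u * int k + s)) {0..<N} {0..<N}"
proof -
  have "inj_on (\<lambda>k. res N (u * int k + s)) {0..<N}"
  proof (rule inj_onI)
    fix k l assume kl: "k \<in> {0..<N}" "l \<in> {0..<N}" "res N (u * int k + s) = res N (u * int l + s)"
    then have "[u * int k = u * int l] (mod int N)"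
      using assms by (simp add: res_eq_iff cong_add_rcancel)
    then have "[int k = int l] (mod int N)"
      using assms by (simp add: cong_mult_lcancel)
    then show "k = l" using kl by (simp add: cong_def)
  qed
  moreover have "(\<lambda>k. res N (u * int k + s)) ` {0..<N} \<subseteq> {0..<N}"
    using assms by auto
  ultimately show ?thesis
    by (simp add: bij_betw_def endo_inj_surj)
qed

text \<open>The identity from \<open>N\<close> on, as \<open>permutes\<close> demands.\<close>

definition mult_perm :: "nat \<Rightarrow> int \<Rightarrow> nat \<Rightarrow> nat" where
  "mult_perm N u i = (if i < N then res N (u * int i) else i)"

lemma mult_perm_permutes:
  assumes "N > 0" "coprime u (int N)"
  shows "mult_perm N u permutes {0..<N}"
proof (rule bij_imp_permutes)
  have "bij_betw (mult_perm N u) {0..<N} {0..<N} \<longleftrightarrow>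
      bij_betw (\<lambda>k. res N (u * int k + 0)) {0..<N} {0..<N}"
    by (rule bij_betw_cong) (simp add: mult_perm_def)
  then show "bij_betw (mult_perm N u) {0..<N} {0..<N}"
    using bij_betw_res_affine[OF assms] by blast
qed (simp add: mult_perm_def)

lemma mult_perm_comp: "N > 0 \<Longrightarrow> mult_perm N u \<circ> mult_perm N v = mult_perm N (u * v)"
  by (auto simp: mult_perm_def fun_eq_iff res_simps mult.assoc)

lemma mult_perm_cong: "[u = v] (mod int N) \<Longrightarrow> mult_perm N u = mult_perm N v"
  by (auto simp: mult_perm_def fun_eq_iff res_eq_iff intro: cong_mult)

lemma mult_perm_1: "mult_perm N 1 = id"
  by (auto simp: mult_perm_def fun_eq_iff res_of_nat)

lemma mult_perm_funpow: "N > 0 \<Longrightarrow> mult_perm N u ^^ k = mult_perm N (u ^ k)"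
  by (induction k) (simp_all add: mult_perm_1 mult_perm_comp del: o_apply)

lemma mult_perm_of_nat: "i < N \<Longrightarrow> mult_perm N (int u) i = (u * i) mod N"
  by (simp add: mult_perm_def res_def flip: of_nat_mult zmod_int)

section \<open>Inversions of multiplication by 2 and by 3\<close>

lemma sum_lessThan_add: "(\<Sum>i<m + n. f i) = (\<Sum>i<m. f i) + (\<Sum>i<n. f (m + i))"
  for f :: "nat \<Rightarrow> 'a :: comm_monoid_add"
  by (induction n) (simp_all add: add.assoc)

lemma sum_diff_lessThan: "(\<Sum>b<q. q - b) = q * (q + 1) div 2" for q :: nat
proof -
  have "(\<Sum>b<q. q - b) = (\<Sum>b<q. Suc b)"
    by (rule sum.reindex_bij_witness[of _ "\<lambda>b. q - Suc b" "\<lambda>b. q - Suc b"]) auto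
  moreover have "2 * (\<Sum>b<q. Suc b) = q * (q + 1)"
    by (induction q) (simp_all add: algebra_simps)
  ultimately show ?thesis by simp
qed

text \<open>Doubling increases on each of the blocks \<open>0..h\<close> and
  \<open>h + 1..2 * h\<close>, so inversions occur only between them. Since \<open>h + 1 + b\<close>
  goes to \<open>2 * b + 1\<close>, it is inverted with exactly the \<open>h - b\<close> indices
  \<open>b + 1..h\<close>.\<close>

lemma sign_mult_perm_2:
  assumes N: "N = 2 * h + 1"
  shows "sign (mult_perm N 2) = (-1) ^ (h * (h + 1) div 2)"
proof -
  define p where "p = mult_perm N 2"
  define invs where "invs j = {i. i < j \<and> p j < p i}" for j
  have p: "p i = (if i \<le> h then 2 * i else 2 * i - N)" if "i < N" for i
    using that mult_perm_of_nat[of i N 2] N by (auto simp: p_def le_mod_geq)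
  have inv_lo: "invs j = {}" if "j < h + 1" for j
    using that N by (auto simp: invs_def p)
  have inv_hi: "invs (h + 1 + b) = {b + 1..h}" if "b < h" for b
    using that N by (auto simp: invs_def p split: if_splits)
  have "(\<Sum>j<N. card (invs j)) = (\<Sum>j<h + 1. card (invs j)) + (\<Sum>b<h. card (invs (h + 1 + b)))"
    using sum_lessThan_add[of "\<lambda>j. card (invs j)" "h + 1" h] N
    by (simp add: mult_2 add.commute add.left_commute)
  also have "(\<Sum>j<h + 1. card (invs j)) = 0"
    by (intro sum.neutral ballI) (subst inv_lo, auto)
  also have "(\<Sum>b<h. card (invs (h + 1 + b))) = (\<Sum>b<h. h - b)"
    by (intro sum.cong refl) (subst inv_hi, auto)
  finally have "(\<Sum>j<N. card (invs j)) = h * (h + 1) div 2"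
    by (simp add: sum_diff_lessThan)
  moreover have "p permutes {0..<N}"
    unfolding p_def by (rule mult_perm_permutes) (simp_all add: N)
  ultimately show ?thesis
    using sign_eq_inversions[of p N] by (simp add: p_def invs_def)
qed

text \<open>Here \<open>1 + s\<close> is the residue of \<open>N\<close> modulo 3. Tripling
  increases on three consecutive blocks of lengths \<open>q + 1\<close>, \<open>q + s\<close> and
  \<open>q\<close>. Each of the three pairs of blocks yields \<open>q * (q + 1) div 2\<close>
  inversions, and three times this number has its parity.\<close>

lemma sign_mult_perm_3:
  assumes N: "N = 3 * q + 1 + s" and s: "s \<le> 1"
  shows "sign (mult_perm N 3) = (-1) ^ (q * (q + 1) div 2)"
proof -
  define p where "p = mult_perm N 3"
  define invs where "invs j = {i. i < j \<and> p j < p i}" for j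
  have p: "p i = (if i \<le> q then 3 * i else if i < 2 * q + 1 + s then 3 * i - N else 3 * i - 2 * N)"
    if "i < N" for i
    using that mult_perm_of_nat[of i N 3] N s by (auto simp: p_def le_mod_geq)
  have inv0: "invs j = {}" if "j < q + 1" for j
    using that N by (auto simp: invs_def p)
  have inv1: "invs (q + 1 + b) = {b + 1..q}" if "b < q + s" for b
    using that N s by (auto simp: invs_def p split: if_splits)
  have inv2: "invs (2 * q + 1 + s + b) = {b + 1..q} \<union> {q + 1 + s + b..<2 * q + 1 + s}" if "b < q" for b
    using that N s by (auto simp: invs_def p split: if_splits)
  have "N = q + 1 + (q + s) + q" using N by simp
  then have "(\<Sum>j<N. card (invs j)) = (\<Sum>j<q + 1. card (invs j)) +
      (\<Sum>b<q + s. card (invs (q + 1 + b))) +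
      (\<Sum>b<q. card (invs (q + 1 + (q + s) + b)))"
    by (simp only: sum_lessThan_add)
  also have "(\<Sum>j<q + 1. card (invs j)) = 0"
    by (intro sum.neutral ballI) (subst inv0, auto)
  also have "(\<Sum>b<q + s. card (invs (q + 1 + b))) = (\<Sum>b<q + s. q - b)"
    by (intro sum.cong refl) (subst inv1, auto)
  \<comment> \<open>For \<open>s = 1\<close> the additional term has \<open>b = q\<close> and
    vanishes.\<close>
  also have "\<dots> = (\<Sum>b<q. q - b)"
    by (simp add: sum_lessThan_add)
  also have "(\<Sum>b<q. card (invs (q + 1 + (q + s) + b))) = (\<Sum>b<q. 2 * (q - b))"
  proof (intro sum.cong refl)
    fix b assume "b \<in> {..<q}"
    then have b: "b < q" by simp
    have "invs (q + 1 + (q + s) + b) = {b + 1..q} \<union> {q + 1 + s + b..<2 * q + 1 + s}"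
      using inv2[OF b] by (simp add: mult_2 add_ac)
    also have "card \<dots> = card {b + 1..q} + card {q + 1 + s + b..<2 * q + 1 + s}"
      by (rule card_Un_disjoint) auto
    finally show "card (invs (q + 1 + (q + s) + b)) = 2 * (q - b)"
      by simp
  qed
  finally have "(\<Sum>j<N. card (invs j)) = q * (q + 1) div 2 + 2 * (q * (q + 1) div 2)"
    by (simp only: sum_distrib_left[symmetric] sum_diff_lessThan)
  moreover have "p permutes {0..<N}"
  proof -
    have "s = 0 \<or> s = 1" using s by auto
    then have "\<not> 3 dvd N" using N by presburger
    then have "coprime (int 3) (int N)"
      unfolding coprime_int_iff by (simp add: prime_imp_coprime)
    then show ?thesis
      unfolding p_def by (intro mult_perm_permutes) (simp_all add: N)
  qed
  ultimately show ?thesis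
    using sign_eq_inversions[of p N] by (simp only: p_def invs_def minus_one_power_iff) simp
qed

subsection \<open>Orbits of doubling\<close>

text \<open>Split off one prime, \<open>N = p * M\<close>. With \<open>m\<close> from
  \<open>M\<close> and \<open>k = ord p 2\<close>, the number \<open>y = 2 ^ (m * k)\<close> is
  \<open>1\<close> modulo both \<open>M\<close> and \<open>p\<close>. In \<open>y ^ p - 1\<close>
  the factor \<open>y - 1\<close> is divisible by \<open>M\<close>, and the other factor, a sum of
  \<open>p\<close> terms congruent to \<open>1\<close>, by \<open>p\<close>. This works also when
  \<open>p\<close> divides \<open>M\<close> again.\<close>

lemma exists_odd_exponent:
  assumes "N > 0" "odd N" "\<And>p. prime p \<Longrightarrow> p dvd N \<Longrightarrow> odd (ord p 2)"
  shows "\<exists>m. odd m \<and> [2 ^ m = 1] (mod int N)"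
  using assms
proof (induction N rule: less_induct)
  case (less N)
  show ?case
  proof (cases "N = 1")
    case True
    then show ?thesis by (intro exI[of _ 1]) (simp add: cong_def)
  next
    case False
    then obtain p where p: "prime p" "p dvd N" using prime_factor_nat by blast
    then obtain M where M: "N = p * M" by blast
    have "M > 0" "odd M" "odd p" using less.prems M by auto
    moreover have "M < N" using M p(1) \<open>M > 0\<close> prime_gt_1_nat by simp
    moreover have "odd (ord q 2)" if "prime q" "q dvd M" for q
      using less.prems(3)[of q] that M by simp
    ultimately obtain m where m: "odd m" "[2 ^ m = 1] (mod int M)"
      using less.IH[of M] by blast
    define k where "k = ord p 2"
    have k: "odd k" "[2 ^ k = 1] (mod p)"
      using less.prems(3) p ord[of 2 p] by (auto simp: k_def)
    define y where "y = (2 :: int) ^ (m * k)"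
    have yM: "[y = 1] (mod int M)"
      using cong_pow[OF m(2), of k] by (simp add: y_def power_mult)
    have "[2 ^ k = 1] (mod int p)"
      using k(2) cong_int_iff[of "2 ^ k" 1 p] by simp
    then have yp: "[y = 1] (mod int p)"
      using cong_pow[of "2 ^ k" 1 "int p" m] by (simp add: y_def mult.commute[of m k] power_mult)
    have "[(\<Sum>i<p. y ^ i) = (\<Sum>i<p. 1)] (mod int p)"
      using cong_pow[OF yp] by (intro cong_sum) simp
    then have "[(\<Sum>i<p. y ^ i) = 0] (mod int p)"
      by (simp add: cong_def)
    then have "int p dvd (\<Sum>i<p. y ^ i)" by (simp add: cong_0_iff)
    moreover have "int M dvd y - 1"
      using yM by (simp add: cong_iff_dvd_diff)
    ultimately have "int p * int M dvd (\<Sum>i<p. y ^ i) * (y - 1)"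
      by (rule mult_dvd_mono)
    then have "int N dvd y ^ p - 1"
      by (simp add: M power_diff_1_eq mult.commute)
    then have "[2 ^ (m * k * p) = 1] (mod int N)"
      by (simp add: y_def power_mult cong_iff_dvd_diff)
    then show ?thesis
      using m(1) k(1) \<open>odd p\<close> by (intro exI[of _ "m * k * p"]) simp
  qed
qed

section \<open>Counting the orbits\<close>

text \<open>After division by the gcd, the cofactor of \<open>x\<close> is a unit modulo
  \<open>N div gcd x N\<close> and cancels. This reduces coincidences in the orbit of
  \<open>x\<close> to powers of 2 modulo that divisor.\<close>

lemma cong_mult_right_iff_div_gcd:
  fixes a b x N :: nat
  assumes "N > 0"
  shows "[a * x = b * x] (mod N) \<longleftrightarrow> [a = b] (mod N div gcd x N)"
proof -
  define e where "e = gcd x N"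
  have "e > 0" using assms by (simp add: e_def)
  have "e dvd x" "e dvd N" by (simp_all add: e_def)
  then obtain x' d where x: "x = e * x'" and N: "N = e * d" by (elim dvdE)
  have "coprime x' d"
    using \<open>e > 0\<close> x N unfolding e_def
    by (metis div_gcd_coprime gcd_eq_0_iff neq0_conv nonzero_mult_div_cancel_left)
  have "[a * x = b * x] (mod N) \<longleftrightarrow> [e * (a * x') = e * (b * x')] (mod e * d)"
    by (simp add: x N mult_ac)
  also have "\<dots> \<longleftrightarrow> [a * x' = b * x'] (mod d)"
    using \<open>e > 0\<close> by (auto simp: cong_def mult_mod_right[symmetric])
  also have "\<dots> \<longleftrightarrow> [a = b] (mod d)"
    using \<open>coprime x' d\<close> by (rule cong_mult_rcancel_nat)
  also have "d = N div gcd x N"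
    unfolding e_def[symmetric] using \<open>e > 0\<close> by (simp add: N)
  finally show ?thesis .
qed

text \<open>Forward iterates suffice: for odd \<open>N\<close> some positive power of 2 is
  \<open>1\<close> modulo \<open>N\<close>, which makes the relation symmetric.\<close>

definition doubling_rel :: "nat \<Rightarrow> (nat \<times> nat) set" where
  "doubling_rel N = {(x, y). x < N \<and> y < N \<and> (\<exists>i. y = 2 ^ i * x mod N)}"

lemma equiv_doubling_rel:
  assumes "N > 0" "odd N"
  shows "equiv {0..<N} (doubling_rel N)"
proof (rule equivI)
  show "doubling_rel N \<subseteq> {0..<N} \<times> {0..<N}" by (auto simp: doubling_rel_def)
  show "refl_on {0..<N} (doubling_rel N)"
    by (auto simp: refl_on_def doubling_rel_def intro: exI[of _ 0])
  show "sym (doubling_rel N)"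
  proof (rule symI)
    fix x y assume "(x, y) \<in> doubling_rel N"
    then obtain i where i: "x < N" "y < N" "y = 2 ^ i * x mod N" by (auto simp: doubling_rel_def)
    define k where "k = ord N 2"
    have "k > 0" using assms by (simp add: k_def)
    have "[2 ^ (k * i) = 1] (mod N)"
      using ord_divides[of 2 "k * i" N] by (simp add: k_def)
    \<comment> \<open>The inverse of \<open>2 ^ i\<close> modulo \<open>N\<close>; the subtraction
      does not truncate, as \<open>k > 0\<close>.\<close>
    moreover have "2 ^ (k * i - i) * 2 ^ i = (2 :: nat) ^ (k * i)"
      using \<open>k > 0\<close> by (simp flip: power_add)
    ultimately have "[2 ^ (k * i - i) * 2 ^ i * x = 1 * x] (mod N)"
      by (metis cong_scalar_right)
    then have "x = 2 ^ (k * i - i) * y mod N"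
      using i by (simp add: cong_def mod_mult_right_eq mult.assoc)
    then show "(y, x) \<in> doubling_rel N" using i by (auto simp: doubling_rel_def)
  qed
  show "trans (doubling_rel N)"
  proof (rule transI)
    fix x y z assume "(x, y) \<in> doubling_rel N" "(y, z) \<in> doubling_rel N"
    then obtain i j where "x < N" "z < N" "y = 2 ^ i * x mod N" "z = 2 ^ j * y mod N"
      by (auto simp: doubling_rel_def)
    moreover from this have "z = 2 ^ (j + i) * x mod N"
      by (simp add: power_add mod_mult_right_eq mult.assoc)
    ultimately show "(x, z) \<in> doubling_rel N" unfolding doubling_rel_def by blast
  qed
qed

text \<open>The iterates \<open>2 ^ i * x\<close> repeat exactly when the exponents agree modulo the
  order of 2 modulo \<open>N div gcd x N\<close>.\<close>

lemma card_doubling_class: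
  assumes "odd N" "x < N"
  shows "card (doubling_rel N `` {x}) = ord (N div gcd x N) 2"
proof -
  define d where "d = N div gcd x N"
  have "d dvd N" unfolding d_def by (metis dvd_mult_div_cancel dvd_triv_right gcd_dvd2)
  then have "odd d" using assms(1) by (metis dvd_trans)
  then have d: "coprime d 2" by simp
  have N: "N > 0" using assms by simp
  let ?f = "\<lambda>i. 2 ^ i * x mod N"
  have eq: "?f i = ?f j \<longleftrightarrow> [i = j] (mod ord d 2)" for i j
    using cong_mult_right_iff_div_gcd[OF N, of "2 ^ i" x "2 ^ j"] order_divides_expdiff[OF d]
    by (simp add: cong_def d_def)
  have "doubling_rel N `` {x} = ?f ` {..<ord d 2}"
  proof (intro equalityI subsetI)
    fix y assume "y \<in> doubling_rel N `` {x}"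
    then obtain i where "y = ?f i" by (auto simp: doubling_rel_def)
    also have "?f i = ?f (i mod ord d 2)" by (simp add: eq cong_def)
    finally show "y \<in> ?f ` {..<ord d 2}" using d by simp
  qed (use assms N in \<open>auto simp: doubling_rel_def\<close>)
  moreover have "inj_on ?f {..<ord d 2}"
    by (rule inj_onI) (simp add: eq cong_def)
  ultimately show ?thesis by (simp add: card_image d_def)
qed

text \<open>\<open>card_gcd_eq_totient\<close> counts over \<open>{0<..N}\<close>. Replacing
  \<open>N\<close> by \<open>0\<close> matters only for \<open>e = N\<close>, where both sets are
  singletons.\<close>

lemma card_less_gcd_eq:
  assumes "N > 0" "e dvd N"
  shows "card {x. x < N \<and> gcd x N = e} = totient (N div e)"
proof -
  have gcd_less: "x < N \<and> gcd x N = N \<longleftrightarrow> x = 0" for x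
    using assms(1) by (metis gcd_0_left_nat gcd_dvd1 nat_dvd_not_less neq0_conv)
  show ?thesis
  proof (cases "e = N")
    case True
    then show ?thesis using assms(1) by (simp add: gcd_less)
  next
    case False
    then have "{x. x < N \<and> gcd x N = e} = {k \<in> {0<..N}. gcd k N = e}"
      by (auto intro: Nat.gr0I simp: le_less)
    then show ?thesis using card_gcd_eq_totient[OF assms] by simp
  qed
qed

text \<open>Powers of 2 are units modulo odd \<open>N\<close>, so the gcd with \<open>N\<close> is
  an invariant by which orbits can be sorted.\<close>

lemma gcd_doubling:
  assumes "odd N" "(x, y) \<in> doubling_rel N"
  shows "gcd y N = gcd x N"
proof -
  obtain i where "y = 2 ^ i * x mod N" using assms(2) by (auto simp: doubling_rel_def)
  moreover have "coprime (2 ^ i) N" using assms(1) by simp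
  ultimately show ?thesis
    by (metis coprime_commute gcd.commute gcd_mult_left_left_cancel gcd_red_nat)
qed

text \<open>Sort the orbits by the common gcd \<open>e\<close> of their members with
  \<open>N\<close>: the \<open>totient (N div e)\<close> residues with this gcd fall into orbits of
  equal size \<open>ord (N div e) 2\<close>. Finally \<open>d = N div e\<close> runs over the
  divisors.\<close>

lemma card_doubling_classes:
  assumes "N > 0" "odd N"
  shows "card ({0..<N} // doubling_rel N) = (\<Sum>d | d dvd N. totient d div ord d 2)"
proof -
  let ?Q = "{0..<N} // doubling_rel N"
  define B where "B e = {x. x < N \<and> gcd x N = e}" for e
  define Q where "Q e = (\<lambda>x. doubling_rel N `` {x}) ` B e" for e
  note eqv = equiv_doubling_rel[OF assms]
  have sub: "doubling_rel N `` {x} \<subseteq> B (gcd x N)" for x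
    using gcd_doubling[OF assms(2)] by (auto simp: B_def doubling_rel_def)
  have self: "x \<in> doubling_rel N `` {x}" if "x < N" for x
    using equiv_class_self[OF eqv] that by simp
  have fin: "finite {e. e dvd N}" using assms(1) by simp
  have "?Q = (\<Union>e\<in>{e. e dvd N}. Q e)"
  proof (intro equalityI subsetI)
    fix C assume "C \<in> ?Q"
    then obtain x where "x < N" "C = doubling_rel N `` {x}" by (auto simp: quotient_def)
    then have "C \<in> Q (gcd x N)" by (auto simp: Q_def B_def)
    then show "C \<in> (\<Union>e\<in>{e. e dvd N}. Q e)" by blast
  qed (auto simp: quotient_def Q_def B_def)
  moreover have "Q e \<inter> Q e' = {}" if "e \<noteq> e'" for e e'
  proof (rule equals0I)
    fix C assume "C \<in> Q e \<inter> Q e'"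
    then obtain x y where x: "x \<in> B e" "C = doubling_rel N `` {x}"
      and y: "y \<in> B e'" "C = doubling_rel N `` {y}" by (auto simp: Q_def)
    then have "x \<in> B (gcd y N)" using self[of x] sub[of y] by (auto simp: B_def)
    then show False using x(1) y(1) that by (simp add: B_def)
  qed
  ultimately have "card ?Q = (\<Sum>e | e dvd N. card (Q e))"
    using fin by (simp add: card_UN_disjoint Q_def B_def)
  also have "\<dots> = (\<Sum>e | e dvd N. totient (N div e) div ord (N div e) 2)"
  proof (intro sum.cong refl)
    fix e assume "e \<in> {e. e dvd N}"
    then have e: "e dvd N" by simp
    have union: "\<Union>(Q e) = B e"
      using sub self by (fastforce simp: Q_def B_def)
    have "ord (N div e) 2 * card (Q e) = card (\<Union>(Q e))"
    proof (rule card_partition)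
      show "finite (Q e)" by (simp add: Q_def B_def)
      show "finite (\<Union>(Q e))" unfolding union by (simp add: B_def)
      show "card C = ord (N div e) 2" if "C \<in> Q e" for C
        using that card_doubling_class[OF assms(2)] by (auto simp: Q_def B_def)
      show "C \<inter> D = {}" if "C \<in> Q e" "D \<in> Q e" "C \<noteq> D" for C D
      proof -
        have "C \<in> ?Q" "D \<in> ?Q" using that by (auto simp: Q_def B_def intro!: quotientI)
        then show ?thesis using quotient_disj[OF eqv] that(3) by blast
      qed
    qed
    also have "\<dots> = totient (N div e)"
      unfolding union using card_less_gcd_eq[OF assms(1) e] by (simp add: B_def)
    finally have *: "ord (N div e) 2 * card (Q e) = totient (N div e)" .
    have "N div e dvd N" using e by (metis dvd_mult_div_cancel dvd_triv_right)
    then have "odd (N div e)" using assms(2) by (metis dvd_trans)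
    then have "ord (N div e) 2 > 0" by simp
    then show "card (Q e) = totient (N div e) div ord (N div e) 2"
      by (metis * nonzero_mult_div_cancel_left neq0_conv)
  qed
  also have "\<dots> = (\<Sum>d | d dvd N. totient d div ord d 2)"
    using assms(1) by (intro sum.reindex_bij_witness[of _ "(div) N" "(div) N"]) (auto elim: dvdE)
  finally show ?thesis .
qed

text \<open>The additional orbit is \<open>{0}\<close>, belonging to the divisor
  \<open>1\<close>.\<close>

lemma card_doubling_classes_amusical_K:
  assumes "N > 0" "odd N"
  shows "card ({0..<N} // doubling_rel N) = amusical_K N + 1"
proof -
  have "{d. d dvd N} = insert 1 {d. d dvd N \<and> d > 1}"
    using assms by (auto simp: Suc_le_eq intro: Nat.gr0I elim: oddE)
  moreover have "finite {d. d dvd N \<and> d > 1}"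
    using assms by simp
  ultimately show ?thesis
    using assms by (simp add: card_doubling_classes amusical_K_def)
qed

subsection \<open>The determinant of the adjacency matrix\<close>

lemma sum_of_bool_left:
  fixes f :: "nat \<Rightarrow> 'a :: semiring_1"
  assumes "a < N"
  shows "(\<Sum>k = 0..<N. of_bool (k = a) * f k) = f a"
proof -
  have "(\<Sum>k = 0..<N. of_bool (k = a) * f k) = (\<Sum>k = 0..<N. if k = a then f k else 0)"
    by (intro sum.cong) auto
  then show ?thesis using assms by simp
qed

lemma sum_of_bool_res_affine:
  assumes "N > 0" "coprime u (int N)" "j < N"
  shows "(\<Sum>k = 0..<N. of_bool (j = res N (u * int k + s))) = (1 :: 'a :: semiring_1)"
proof -
  have "(\<Sum>k = 0..<N. of_bool (j = res N (u * int k + s))) = (\<Sum>l = 0..<N. of_bool (j = l) :: 'a)"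
    by (rule sum.reindex_bij_betw[OF bij_betw_res_affine[OF assms(1,2)]])
  also have "\<dots> = (\<Sum>l = 0..<N. of_bool (l = j) * 1)"
    by (intro sum.cong) auto
  finally show ?thesis by (simp only: sum_of_bool_left[OF assms(3)])
qed

lemma index_mult_mat_fun:
  "i < N \<Longrightarrow> j < N \<Longrightarrow>
    (mat N N f * mat N N g) $$ (i, j) = (\<Sum>k = 0..<N. f (i, k) * g (k, j))"
  by (simp add: scalar_prod_def)

lemma det_two_shifts_plus_doubling:
  fixes N :: nat and t :: int
  assumes N: "N > 1" "odd N" and t: "[4 * t = 1] (mod int N)"
  shows "2 * det (mat N N (\<lambda>(i, j). of_bool (j = res N (2 * int i)) +
      of_bool (j = res N (int i + t)) + of_bool (j = res N (int i - t))) :: rat mat) =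
    3 * det (mat N N (\<lambda>(i, j). of_bool (j = i) + of_bool (j = mult_perm N 2 i)))"
proof -
  have N0: "N > 0" using N by simp
  have cop: "coprime 2 (int N)" using N by simp
  define A where "A = (\<lambda>(i, j). of_bool (j = res N (2 * int i)) +
      of_bool (j = res N (int i + t)) + (of_bool (j = res N (int i - t)) :: rat))"
  define B where "B = (\<lambda>(i, j). of_bool (j = i) + (of_bool (j = mult_perm N 2 i) :: rat))"
  define D where "D = (\<lambda>(i, j). of_bool (j = mult_perm N 2 i) :: rat)"
  define G where "G = (\<lambda>(i, j). of_bool (j = res N (int i + t)) - of_bool (j = res N (int i - t)) + (2 :: rat))"
  define H where "H x = (\<lambda>(i, j). of_bool (j = res N (int i + 2 * t)) -
      of_bool (j = res N (int i - 2 * t)) + (x :: rat))" for x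
  define E where "E = (\<lambda>(i :: nat, j). of_bool (i = j) + 1 / (2 * of_nat N :: rat))"
  \<comment> \<open>Column sums are what the all-ones summands see in a matrix product.\<close>
  have col2: "(\<Sum>k = 0..<N. of_bool (j = res N (2 * int k))) = (1 :: rat)" if "j < N" for j
    using sum_of_bool_res_affine[OF N0 cop that, of 0, where 'a = rat] by (simp del: sum_of_bool_eq)
  have col_plus: "(\<Sum>k = 0..<N. of_bool (j = res N (int k + s))) = (1 :: rat)" if "j < N" for j s
    using sum_of_bool_res_affine[OF N0 _ that, of 1 s, where 'a = rat] by (simp del: sum_of_bool_eq)
  have col_minus: "(\<Sum>k = 0..<N. of_bool (j = res N (int k - s))) = (1 :: rat)" if "j < N" for j s
    using col_plus[OF that, of "- s"] by (simp del: sum_of_bool_eq)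
  have G_sum: "(\<Sum>k = 0..<N. G (i, k) * f k) =
      f (res N (int i + t)) - f (res N (int i - t)) + 2 * (\<Sum>k = 0..<N. f k)" for i f
    using N0 by (simp add: G_def distrib_right left_diff_distrib sum.distrib sum_subtractf
        sum_of_bool_left flip: sum_distrib_left)
  have B_sum: "(\<Sum>k = 0..<N. B (i, k) * f k) = f i + f (mult_perm N 2 i)" if "i < N" for i f
    using that N0 by (simp add: B_def distrib_right sum.distrib sum_of_bool_left mult_perm_def)
  have D_sum: "(\<Sum>k = 0..<N. D (i, k) * f k) = f (mult_perm N 2 i)" if "i < N" for i f
    using that N0 by (simp add: D_def sum_of_bool_left mult_perm_def)
  have E_sum: "(\<Sum>k = 0..<N. E (i, k) * f k) = f i + (\<Sum>k = 0..<N. f k) / (2 * of_nat N)" if "i < N" for i f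
    using that sum_of_bool_left[OF that, of f]
    by (simp add: E_def distrib_right sum.distrib eq_commute[of i] flip: sum_divide_distrib)
  have H_col: "(\<Sum>k = 0..<N. H x (k, j)) = of_nat N * x" if "j < N" for j x
    by (simp add: H_def sum.distrib sum_subtractf col_plus[OF that] col_minus[OF that] del: sum_of_bool_eq)
  have A_col: "(\<Sum>k = 0..<N. A (k, j)) = 3" if "j < N" for j
    by (simp add: A_def sum.distrib col2[OF that] col_plus[OF that] col_minus[OF that] del: sum_of_bool_eq)
  have two_t: "x + t + t = x + 2 * t" "x - t - t = x - 2 * t" for x :: int by simp_all
  txt \<open>In terms of the shift \<open>T\<close> by \<open>t\<close>, the doubling \<open>D\<close> and the all-ones matrix \<open>J\<close>, these are
    \<open>G = T - T\<inverse> + 2J\<close>, \<open>H x = T\<^sup>2 - T\<^sup>-\<^sup>2 + xJ\<close> and \<open>E = 1 + J / 2N\<close>. Multiples of \<open>J\<close> are added because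
    \<open>T - T\<inverse>\<close> annihilates the constants.\<close>
  have GA: "mat N N G * mat N N A = mat N N B * mat N N (H 3)"
  proof (rule eq_matI)
    fix i j assume "i < dim_row (mat N N B * mat N N (H 3))" "j < dim_col (mat N N B * mat N N (H 3))"
    then have ij: "i < N" "j < N" by simp_all
    show "(mat N N G * mat N N A) $$ (i, j) = (mat N N B * mat N N (H 3)) $$ (i, j)"
      unfolding index_mult_mat_fun[OF ij] G_sum B_sum[OF ij(1)] A_col[OF ij(2)]
      using ij N0 by (simp add: A_def H_def mult_perm_def res_simps two_t)
  qed simp_all
  \<comment> \<open>The columns of \<open>H 2\<close> sum to \<open>2 * N\<close>, so
    \<open>J / 2N\<close> adds exactly one \<open>J\<close>.\<close>
  have EH: "mat N N E * mat N N (H 2) = mat N N (H 3)"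
  proof (rule eq_matI)
    fix i j assume "i < dim_row (mat N N (H 3))" "j < dim_col (mat N N (H 3))"
    then have ij: "i < N" "j < N" by simp_all
    show "(mat N N E * mat N N (H 2)) $$ (i, j) = mat N N (H 3) $$ (i, j)"
      unfolding index_mult_mat_fun[OF ij] E_sum[OF ij(1)] H_col[OF ij(2)]
      using ij N0 by (simp add: H_def)
  qed simp_all
  \<comment> \<open>\<open>D\<close> is a permutation matrix and fixes \<open>J\<close> from both
    sides, so the same multiple \<open>2J\<close> in \<open>G\<close> and \<open>H 2\<close> makes
    them conjugate.\<close>
  have DH: "mat N N D * mat N N (H 2) = mat N N G * mat N N D"
  proof (rule eq_matI)
    fix i j assume "i < dim_row (mat N N G * mat N N D)" "j < dim_col (mat N N G * mat N N D)"
    then have ij: "i < N" "j < N" by simp_all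
    have "(\<Sum>k = 0..<N. D (k, j)) = (\<Sum>k = 0..<N. of_bool (j = res N (2 * int k)))"
      by (intro sum.cong) (simp_all add: D_def mult_perm_def)
    then have D_col: "(\<Sum>k = 0..<N. D (k, j)) = 1" by (simp only: col2[OF ij(2)])
    show "(mat N N D * mat N N (H 2)) $$ (i, j) = (mat N N G * mat N N D) $$ (i, j)"
      unfolding index_mult_mat_fun[OF ij] G_sum D_sum[OF ij(1)] D_col
      using ij N0 by (simp add: D_def H_def mult_perm_def res_simps right_diff_distrib)
  qed simp_all
  have detE: "det (mat N N E) = 3 / 2"
    using det_one_plus_const[OF N0, of "1 / (2 * of_nat N :: rat)"] N0 by (simp add: E_def)
  have detD: "det (mat N N D) \<noteq> 0"
  proof -
    have "mat N N D = mat N N (\<lambda>(i, j). 1\<^sub>m N $$ (mult_perm N 2 i, j))"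
      by (rule eq_matI) (auto simp: D_def mult_perm_def N0)
    then have "det (mat N N D) = signof (mult_perm N 2)"
      using det_permute_rows[OF one_carrier_mat mult_perm_permutes[OF N0 cop]] by simp
    then show ?thesis by simp
  qed
  \<comment> \<open>For a kernel vector, adding all rows cancels the shifts and forces coordinate
    sum \<open>S = 0\<close>. Then the vector is invariant under the shift by \<open>2 * t\<close>,
    hence under \<open>4 * t\<close>, which is \<open>1\<close> modulo \<open>N\<close>. So it is
    constant, and \<open>S = 0\<close> makes it zero.\<close>
  have detG: "det (mat N N G) \<noteq> 0"
  proof
    assume "det (mat N N G) = 0"
    then obtain v where v: "v \<in> carrier_vec N" "v \<noteq> 0\<^sub>v N" "mat N N G *\<^sub>v v = 0\<^sub>v N"
      using det_0_iff_vec_prod_zero[of "mat N N G" N] by auto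
    define S where "S = (\<Sum>k = 0..<N. v $ k)"
    have eq: "v $ res N (int i + t) - v $ res N (int i - t) + 2 * S = 0" if "i < N" for i
    proof -
      have "(mat N N G *\<^sub>v v) $ i = (\<Sum>k = 0..<N. G (i, k) * v $ k)"
        using that v(1) by (simp add: mult_mat_vec_def scalar_prod_def)
      then show ?thesis using v(3) that by (simp add: G_sum S_def)
    qed
    have shift: "(\<Sum>i = 0..<N. v $ res N (int i + s)) = S" for s
      using sum.reindex_bij_betw[OF bij_betw_res_affine[OF N0, of 1 s], of "\<lambda>k. v $ k"]
      by (simp add: S_def)
    have "(\<Sum>i = 0..<N. v $ res N (int i + t) - v $ res N (int i - t) + 2 * S) = 0"
      using eq by simp
    then have "S = 0"
      using N0 shift[of t] shift[of "- t"] by (simp add: sum.distrib sum_subtractf)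
    have step: "v $ res N (x + 2 * t) = v $ res N x" for x
      using eq[of "res N (x + t)"] \<open>S = 0\<close> N0 by (simp add: res_simps two_t)
    have step1: "v $ res N (x + 1) = v $ res N x" for x
    proof -
      have "res N (x + 1) = res N (x + 2 * t + 2 * t)"
        using cong_add[OF cong_refl[of x] cong_sym[OF t]] N0 by (simp add: res_eq_iff add.assoc)
      then show ?thesis by (simp only: step)
    qed
    have "v $ res N (int i) = v $ 0" for i
    proof (induction i)
      case 0
      then show ?case using N0 res_of_nat[of 0 N] by simp
    next
      case (Suc i)
      then show ?case using step1[of "int i"] by (simp add: add.commute)
    qed
    then have const: "v $ i = v $ 0" if "i < N" for i
      using res_of_nat[OF that] by metis
    have "S = (\<Sum>k = 0..<N. v $ 0)"
      unfolding S_def by (intro sum.cong refl const) simp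
    then have "v $ 0 = 0" using \<open>S = 0\<close> N0 by simp
    then have "v $ i = 0" if "i < N" for i
      using const[OF that] by (rule trans[rotated])
    then have "v = 0\<^sub>v N"
      using v(1) by (intro eq_vecI) auto
    then show False using v(2) by simp
  qed
  have "det (mat N N (H 2)) = det (mat N N G)"
    using DH detD det_mult[of "mat N N D" N "mat N N (H 2)"] det_mult[of "mat N N G" N "mat N N D"] by simp
  moreover have "det (mat N N (H 3)) = 3 / 2 * det (mat N N (H 2))"
    using EH detE det_mult[of "mat N N E" N "mat N N (H 2)"] by simp
  moreover have "det (mat N N G) * det (mat N N A) = det (mat N N B) * det (mat N N (H 3))"
    using GA det_mult[of "mat N N G" N "mat N N A"] det_mult[of "mat N N B" N "mat N N (H 3)"] by simp
  ultimately have "det (mat N N G) * det (mat N N A) = det (mat N N G) * (3 / 2 * det (mat N N B))"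
    by (simp only: mult_ac)
  then have "det (mat N N A) = 3 / 2 * det (mat N N B)"
    using detG mult_left_cancel by blast
  then show ?thesis by (simp add: A_def B_def)
qed

section \<open>The adjacency matrix with permuted rows\<close>

text \<open>By the Chinese remainder theorem some \<open>n\<close> in the class of \<open>a\<close>
  satisfies the rule's condition modulo \<open>m\<close>, and the class of
  \<open>amusical_U n\<close> does not depend on which one. In use, \<open>k\<close> is the
  denominator 2 or 4 and \<open>e\<close> is 0, 1 or -1.\<close>

lemma amusical_rule_edge_iff:
  assumes "coprime N m" "coprime k (int N)"
    and R: "\<And>n. R n \<longleftrightarrow> [n = c] (mod m)"
    and U: "\<And>n. R n \<Longrightarrow> k * int (amusical_U n) = 3 * int n + e"
  shows "amusical_rule_edge R N a b \<longleftrightarrow> [k * int b = 3 * int a + e] (mod int N)"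
proof -
  have *: "[amusical_U n = b] (mod N) \<longleftrightarrow> [k * int b = 3 * int a + e] (mod int N)"
    if "R n" "[n = a] (mod N)" for n
  proof -
    have "[3 * int n + e = 3 * int a + e] (mod int N)"
      using that(2) by (intro cong_add cong_mult cong_refl) (simp add: cong_int_iff)
    then have eq: "[k * int (amusical_U n) = 3 * int a + e] (mod int N)"
      by (simp add: U[OF that(1)])
    have "[amusical_U n = b] (mod N) \<longleftrightarrow> [k * int (amusical_U n) = k * int b] (mod int N)"
      using assms(2) by (simp add: cong_mult_lcancel cong_int_iff)
    also have "\<dots> \<longleftrightarrow> [k * int b = 3 * int a + e] (mod int N)"
      using eq by (metis cong_sym cong_trans)
    finally show ?thesis .
  qed
  obtain n where "[n = a] (mod N)" "[n = c] (mod m)"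
    using binary_chinese_remainder_nat[OF assms(1)] by blast
  then show ?thesis
    unfolding amusical_rule_edge_def using * R by blast
qed

lemma det_amusical_adj:
  assumes N: "N > 1" "odd N" and "\<not> 3 dvd N"
  shows "2 * of_int (det (amusical_adj N)) = of_int (sign (mult_perm N 3)) *
    (3 * det (mat N N (\<lambda>(i, j). of_bool (j = i) + of_bool (j = mult_perm N 2 i)) :: rat mat))"
proof -
  have N0: "N > 0" using N by simp
  have cop2: "coprime 2 (int N)" using N by simp
  then have cop4: "coprime 4 (int N)"
    using coprime_power_left_iff[of 2 2 "int N"] by simp
  have cop3: "coprime 3 (int N)"
    using \<open>\<not> 3 dvd N\<close> coprime_int_iff[of 3 N] by (simp add: prime_imp_coprime)
  obtain t where t: "[4 * t = 1] (mod int N)"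
    using cong_solve_coprime_int[OF cop4] by blast
  \<comment> \<open>Modulo \<open>N\<close>, \<open>t\<close> is \<open>1/4\<close> and
    \<open>u\<close> is \<open>3/4\<close>. Row \<open>a\<close> of the adjacency matrix will be row
    \<open>u * a\<close> of \<open>A\<close>.\<close>
  define u where "u = 3 * t"
  have u: "[4 * u = 3] (mod int N)"
    using cong_mult[OF cong_refl[of 3] t] by (simp add: u_def mult.left_commute)
  have "coprime t (int N)"
    using t by (metis cong_imp_coprime cong_sym coprime_1_left coprime_mult_left_iff)
  then have copu: "coprime u (int N)"
    using cop3 by (simp add: u_def)
  define A :: "rat mat" where "A = mat N N (\<lambda>(i, j). of_bool (j = res N (2 * int i)) +
      of_bool (j = res N (int i + t)) + of_bool (j = res N (int i - t)))"
  have "map_mat of_int (amusical_adj N) = mat N N (\<lambda>(i, j). A $$ (mult_perm N u i, j))"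
  proof (rule eq_matI)
    fix a b assume "a < dim_row (mat N N (\<lambda>(i, j). A $$ (mult_perm N u i, j)))"
      "b < dim_col (mat N N (\<lambda>(i, j). A $$ (mult_perm N u i, j)))"
    then have ab: "a < N" "b < N" by simp_all
    have ua: "[4 * (u * int a) = 3 * int a] (mod int N)"
      using cong_mult[OF u cong_refl[of "int a"]] by (simp add: mult.assoc)
    have "amusical_rule_edge even N a b \<longleftrightarrow> [2 * int b = 3 * int a + 0] (mod int N)"
    proof (rule amusical_rule_edge_iff[where m = 2 and c = 0])
      show "2 * int (amusical_U n) = 3 * int n + 0" if "even n" for n
        using amusical_U_exact(1)[OF that] by linarith
    qed (use N cop2 in \<open>simp_all add: cong_0_iff\<close>)
    also have "\<dots> \<longleftrightarrow> [2 * int b = 2 * (2 * (u * int a))] (mod int N)"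
      using ua by (simp add: cong_def)
    also have "\<dots> \<longleftrightarrow> b = res N (2 * (u * int a))"
      using cop2 ab N0 by (simp only: cong_mult_lcancel eq_res_iff)
    finally have e0: "amusical_rule_edge even N a b \<longleftrightarrow> b = res N (2 * (u * int a))" .
    have "amusical_rule_edge (\<lambda>n. [n = 1] (mod 4)) N a b \<longleftrightarrow> [4 * int b = 3 * int a + 1] (mod int N)"
    proof (rule amusical_rule_edge_iff[where m = 4 and c = 1])
      show "4 * int (amusical_U n) = 3 * int n + 1" if "[n = 1] (mod 4)" for n
        using amusical_U_exact(2)[OF that] by linarith
      show "coprime N 4" using cop4 coprime_int_iff[of 4 N] by (simp add: coprime_commute)
    qed (use cop4 in simp_all)
    also have "\<dots> \<longleftrightarrow> [4 * int b = 4 * (u * int a + t)] (mod int N)"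
      using cong_add[OF ua t] by (simp add: cong_def distrib_left)
    also have "\<dots> \<longleftrightarrow> b = res N (u * int a + t)"
      using cop4 ab N0 by (simp only: cong_mult_lcancel eq_res_iff)
    finally have e1: "amusical_rule_edge (\<lambda>n. [n = 1] (mod 4)) N a b \<longleftrightarrow> b = res N (u * int a + t)" .
    have "amusical_rule_edge (\<lambda>n. [n = 3] (mod 4)) N a b \<longleftrightarrow> [4 * int b = 3 * int a + (- 1)] (mod int N)"
    proof (rule amusical_rule_edge_iff[where m = 4 and c = 3])
      show "4 * int (amusical_U n) = 3 * int n + (- 1)" if "[n = 3] (mod 4)" for n
        using amusical_U_exact(3)[OF that] by linarith
      show "coprime N 4" using cop4 coprime_int_iff[of 4 N] by (simp add: coprime_commute)
    qed (use cop4 in simp_all)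
    also have "\<dots> \<longleftrightarrow> [4 * int b = 4 * (u * int a - t)] (mod int N)"
      using cong_diff[OF ua t] by (simp add: cong_def right_diff_distrib)
    also have "\<dots> \<longleftrightarrow> b = res N (u * int a - t)"
      using cop4 ab N0 by (simp only: cong_mult_lcancel eq_res_iff)
    finally have e3: "amusical_rule_edge (\<lambda>n. [n = 3] (mod 4)) N a b \<longleftrightarrow> b = res N (u * int a - t)" .
    show "map_mat of_int (amusical_adj N) $$ (a, b) = mat N N (\<lambda>(i, j). A $$ (mult_perm N u i, j)) $$ (a, b)"
      using ab N0 by (simp add: amusical_adj_def A_def e0 e1 e3 mult_perm_def res_simps del: One_nat_def)
  qed (simp_all add: amusical_adj_def)
  then have "of_int (det (amusical_adj N)) = signof (mult_perm N u) * det A"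
    using det_permute_rows[of A N "mult_perm N u"] mult_perm_permutes[OF N0 copu]
    by (simp add: A_def flip: of_int_hom.hom_det)
  moreover have "sign (mult_perm N u) = sign (mult_perm N 3)"
  proof -
    have perm: "permutation (mult_perm N v)" if "coprime v (int N)" for v
      using mult_perm_permutes[OF N0 that] permutation_permutes by blast
    \<comment> \<open>Multiplication by 3 differs from that by \<open>u\<close> by two doublings,
      whose signs cancel.\<close>
    have "mult_perm N 3 = mult_perm N (2 * (2 * u))"
      using u by (intro mult_perm_cong) (simp add: cong_sym)
    also have "\<dots> = mult_perm N 2 \<circ> (mult_perm N 2 \<circ> mult_perm N u)"
      by (simp only: mult_perm_comp[OF N0])
    finally show ?thesis
      using perm[OF cop2] perm[OF copu] by (simp add: sign_compose permutation_compose del: o_apply)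
  qed
  moreover have "2 * det A = 3 * det (mat N N (\<lambda>(i, j). of_bool (j = i) + of_bool (j = mult_perm N 2 i)))"
    unfolding A_def by (rule det_two_shifts_plus_doubling[OF N t])
  ultimately show ?thesis by simp
qed

section \<open>The determinant of \<open>1 + D\<close>\<close>

lemma det_one_plus_doubling_eq_0:
  assumes N: "N > 1" "odd N" and p: "prime p" "p dvd N" "even (ord p 2)"
  shows "det (mat N N (\<lambda>(i, j). of_bool (j = i) + of_bool (j = mult_perm N 2 i)) :: 'a :: idom mat) = 0"
proof -
  txt \<open>The kernel vector is \<open>1\<close> on the residues that are even powers of \<open>2\<close> modulo \<open>p\<close>,
    \<open>- 1\<close> on the odd powers and \<open>0\<close> elsewhere.\<close>
  define P where "P s c \<longleftrightarrow> (\<exists>i. even i = s \<and> [c = 2 ^ i] (mod p))" for s and c :: nat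
  have "odd p" using N(2) p(2) by (metis dvd_trans)
  then have cop: "coprime p 2" by simp
  then have ord_pos: "ord p 2 > 0" by simp
  have P_double: "P s (2 * c mod N) \<longleftrightarrow> P (\<not> s) c" for s c
  proof -
    have "[2 * c mod N = 2 * c] (mod p)"
      using p(2) by (simp add: cong_def mod_mod_cancel)
    then have "P s (2 * c mod N) \<longleftrightarrow> P s (2 * c)"
      unfolding P_def by (metis cong_sym cong_trans)
    also have "\<dots> \<longleftrightarrow> P (\<not> s) c"
    proof
      assume "P s (2 * c)"
      then obtain i where i: "even i = s" "[2 * c = 2 ^ i] (mod p)" by (auto simp: P_def)
      \<comment> \<open>Halving lowers the exponent by one. Adding the order first covers
        \<open>i = 0\<close>, and since the order is even the parity is that of
        \<open>i - 1\<close>.\<close>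
      define l where "l = i + ord p 2 - 1"
      have l: "Suc l = i + ord p 2" using ord_pos by (simp add: l_def)
      have "[2 ^ i = 2 ^ Suc l] (mod p)"
        unfolding l by (subst order_divides_expdiff[OF cop]) (simp add: cong_def)
      then have "[2 * c = 2 * 2 ^ l] (mod p)"
        using cong_trans[OF i(2)] by simp
      then have "[c = 2 ^ l] (mod p)"
        using cop by (simp add: cong_mult_lcancel_nat coprime_commute)
      moreover have "even l = (\<not> s)"
        using l i(1) p(3) by (metis even_Suc even_add)
      ultimately show "P (\<not> s) c" by (auto simp: P_def)
    next
      assume "P (\<not> s) c"
      then obtain i where i: "even i = (\<not> s)" "[c = 2 ^ i] (mod p)" by (auto simp: P_def)
      then have "[2 * c = 2 ^ Suc i] (mod p)"
        by (simp add: cong_scalar_left)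
      moreover have "even (Suc i) = s" using i(1) by simp
      ultimately show "P s (2 * c)" unfolding P_def by blast
    qed
    finally show ?thesis .
  qed
  \<comment> \<open>With even order, no odd power of 2 is \<open>1\<close> modulo \<open>p\<close>.
    So the vector has entry \<open>1\<close> at index \<open>1\<close> and is nonzero.\<close>
  have P_excl: "\<not> P False 1"
  proof
    assume "P False 1"
    then obtain i where "odd i" "[1 = 2 ^ i] (mod p)" by (auto simp: P_def)
    then have "ord p 2 dvd i" using ord_divides[of 2 i p] by (simp add: cong_sym)
    then show False using p(3) \<open>odd i\<close> by (metis dvd_trans)
  qed
  have "P True 1" unfolding P_def by (intro exI[of _ 0]) simp
  let ?M = "mat N N (\<lambda>(i, j). of_bool (j = i) + of_bool (j = mult_perm N 2 i)) :: 'a mat"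
  define f :: "nat \<Rightarrow> 'a" where "f c = of_bool (P True c) - of_bool (P False c)" for c
  have "?M *\<^sub>v vec N f = 0\<^sub>v N"
  proof (rule eq_vecI)
    fix i assume "i < dim_vec (0\<^sub>v N :: 'a vec)"
    then have i: "i < N" by simp
    have "(?M *\<^sub>v vec N f) $ i = (\<Sum>j = 0..<N. (of_bool (j = i) + of_bool (j = mult_perm N 2 i)) * f j)"
      using i by (simp add: mult_mat_vec_def scalar_prod_def)
    also have "\<dots> = f i + f (mult_perm N 2 i)"
      using i by (simp add: distrib_right sum.distrib sum_of_bool_left mult_perm_def)
    also have "mult_perm N 2 i = 2 * i mod N"
      using mult_perm_of_nat[OF i, of 2] by simp
    also have "f i + f (2 * i mod N) = 0"
      by (simp add: f_def P_double)
    finally show "(?M *\<^sub>v vec N f) $ i = 0\<^sub>v N $ i" using i by simp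
  qed simp
  moreover have "vec N f \<noteq> 0\<^sub>v N"
  proof
    assume "vec N f = 0\<^sub>v N"
    then have "vec N f $ 1 = 0\<^sub>v N $ 1" by simp
    then show False using N(1) \<open>P True 1\<close> P_excl by (simp add: f_def)
  qed
  ultimately have "\<exists>v. v \<in> carrier_vec N \<and> v \<noteq> 0\<^sub>v N \<and> ?M *\<^sub>v v = 0\<^sub>v N"
    by (intro exI[of _ "vec N f"]) simp
  then show ?thesis
    by (subst det_0_iff_vec_prod_zero[of _ N]) simp_all
qed

text \<open>Links the invariant sets counted by \<open>det_one_plus_permutation\<close> with the
  unions of orbits counted by \<open>card_saturated_subsets\<close>.\<close>

lemma doubling_closed_iff:
  assumes "X \<subseteq> {0..<N}"
  shows "mult_perm N 2 ` X \<subseteq> X \<longleftrightarrow> doubling_rel N `` X \<subseteq> X"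
proof
  assume closed: "mult_perm N 2 ` X \<subseteq> X"
  have "2 ^ i * x mod N \<in> X" if "x \<in> X" for i x
  proof (induction i)
    case 0
    then show ?case using that assms by auto
  next
    case (Suc i)
    then have "mult_perm N 2 (2 ^ i * x mod N) \<in> X" using closed by blast
    moreover have "2 ^ i * x mod N < N" using Suc assms by auto
    ultimately show ?case
      using mult_perm_of_nat[of "2 ^ i * x mod N" N 2] by (simp add: mod_mult_right_eq mult.assoc)
  qed
  then show "doubling_rel N `` X \<subseteq> X" by (auto simp: doubling_rel_def)
next
  assume closed: "doubling_rel N `` X \<subseteq> X"
  show "mult_perm N 2 ` X \<subseteq> X"
  proof
    fix y assume "y \<in> mult_perm N 2 ` X"
    then obtain x where x: "x \<in> X" "y = mult_perm N 2 x" by blast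
    then have "x < N" using assms by auto
    then have "y = 2 ^ 1 * x mod N" using x mult_perm_of_nat[of x N 2] by simp
    moreover have "y < N" using \<open>x < N\<close> calculation by simp
    ultimately have "(x, y) \<in> doubling_rel N" using \<open>x < N\<close> unfolding doubling_rel_def by blast
    then show "y \<in> X" using closed x by blast
  qed
qed

text \<open>The \<open>1\<close> in the exponent, from the orbit \<open>{0}\<close>, later cancels
  the factor 2 on the left of \<open>det_amusical_adj\<close>.\<close>

lemma det_one_plus_doubling_odd:
  assumes N: "N > 1" "odd N" and m: "odd m" "[2 ^ m = 1] (mod int N)"
  shows "det (mat N N (\<lambda>(i, j). of_bool (j = i) + of_bool (j = mult_perm N 2 i)) :: 'a :: comm_ring_1 mat)
    = 2 ^ (amusical_K N + 1)"
proof -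
  have N0: "N > 0" using N by simp
  have "mult_perm N 2 ^^ m = id"
    using mult_perm_cong[OF m(2)] by (simp add: mult_perm_funpow[OF N0] mult_perm_1)
  then have "det (mat N N (\<lambda>(i, j). of_bool (j = i) + of_bool (j = mult_perm N 2 i)) :: 'a mat) =
      of_nat (card {X. X \<subseteq> {0..<N} \<and> mult_perm N 2 ` X \<subseteq> X})"
    using N by (intro det_one_plus_permutation[OF mult_perm_permutes[OF N0] m(1)]) simp_all
  also have "{X. X \<subseteq> {0..<N} \<and> mult_perm N 2 ` X \<subseteq> X} = {X. X \<subseteq> {0..<N} \<and> doubling_rel N `` X \<subseteq> X}"
    using doubling_closed_iff by blast
  also have "card \<dots> = 2 ^ card ({0..<N} // doubling_rel N)"
    by (rule card_saturated_subsets[OF equiv_doubling_rel[OF N0 N(2)]]) simp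
  finally show ?thesis
    by (simp add: card_doubling_classes_amusical_K[OF N0 N(2)])
qed

section \<open>Signs and residues modulo 8 and 24\<close>

lemma even_triangular_iff: "even (q * (q + 1) div 2) \<longleftrightarrow> q mod 4 = 0 \<or> q mod 4 = 3" for q :: nat
proof -
  define a where "a = q div 4"
  define b where "b = q mod 4"
  have q: "q = 4 * a + b" by (simp add: a_def b_def)
  have "b < 4" by (simp add: b_def)
  then consider "b = 0" | "b = 1" | "b = 2" | "b = 3" by linarith
  then have "even (q * (q + 1) div 2) \<longleftrightarrow> b = 0 \<or> b = 3"
  proof cases
    case 1
    then have "q * (q + 1) = 2 * (2 * (a * (q + 1)))" using q by simp
    then have "q * (q + 1) div 2 = 2 * (a * (q + 1))" by simp
    then show ?thesis using 1 by simp
  next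
    case 2
    then have "q * (q + 1) = 2 * (2 * (4 * a * a + 3 * a) + 1)" using q by (simp add: algebra_simps)
    then have "q * (q + 1) div 2 = 2 * (4 * a * a + 3 * a) + 1" by simp
    then show ?thesis using 2 by simp
  next
    case 3
    then have "q * (q + 1) = 2 * (2 * (4 * a * a + 5 * a + 1) + 1)" using q by (simp add: algebra_simps)
    then have "q * (q + 1) div 2 = 2 * (4 * a * a + 5 * a + 1) + 1" by simp
    then show ?thesis using 3 by simp
  next
    case 4
    then have "q * (q + 1) = 2 * (2 * (q * (a + 1)))" using q by (simp add: algebra_simps)
    then have "q * (q + 1) div 2 = 2 * (q * (a + 1))" by simp
    then show ?thesis using 4 by simp
  qed
  then show ?thesis by (simp add: b_def)
qed

text \<open>In the four cases \<open>q\<close> is \<open>8 * k\<close> plus 0, 7, 2 or 5, so its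
  residue modulo 4 is fixed. These are the residues coprime to 24 that
  \<open>odd_order_mod_8\<close> admits.\<close>

lemma sign_mult_perm_3_mod_24:
  shows "N mod 24 = 1 \<Longrightarrow> sign (mult_perm N 3) = 1" "N mod 24 = 23 \<Longrightarrow> sign (mult_perm N 3) = 1"
    "N mod 24 = 7 \<Longrightarrow> sign (mult_perm N 3) = - 1" "N mod 24 = 17 \<Longrightarrow> sign (mult_perm N 3) = - 1"
proof -
  define k where "k = N div 24"
  have N: "N = 24 * k + N mod 24" by (simp add: k_def)
  have *: "sign (mult_perm N 3) = (if q mod 4 = 0 \<or> q mod 4 = 3 then 1 else - 1)"
    if "N = 3 * q + 1 + s" "s \<le> 1" for q s
    unfolding sign_mult_perm_3[OF that] minus_one_power_iff even_triangular_iff ..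
  have mod4: "(8 * k + c) mod 4 = c mod 4" for c
    using mod_mult_self2[of c 4 "2 * k"] by (simp add: add.commute)
  show "sign (mult_perm N 3) = 1" if "N mod 24 = 1"
    using *[of "8 * k + 0" 0] mod4[of 0] N that by simp
  show "sign (mult_perm N 3) = 1" if "N mod 24 = 23"
    using *[of "8 * k + 7" 1] mod4[of 7] N that by simp
  show "sign (mult_perm N 3) = - 1" if "N mod 24 = 7"
    using *[of "8 * k + 2" 0] mod4[of 2] N that by simp
  show "sign (mult_perm N 3) = - 1" if "N mod 24 = 17"
    using *[of "8 * k + 5" 1] mod4[of 5] N that by simp
qed

text \<open>Doubling has odd order and is therefore even, so its inversion number
  \<open>h * (h + 1) div 2\<close> is even. This restricts \<open>h\<close> modulo 4 and hence
  \<open>N = 2 * h + 1\<close> modulo 8.\<close>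

lemma odd_order_mod_8:
  assumes N: "N > 1" "odd N" and m: "odd m" "[2 ^ m = 1] (mod int N)"
  shows "N mod 8 = 1 \<or> N mod 8 = 7"
proof -
  have N0: "N > 0" using N by simp
  obtain h where h: "N = 2 * h + 1" using N(2) by (elim oddE)
  have "mult_perm N 2 ^^ m = id"
    using mult_perm_cong[OF m(2)] by (simp add: mult_perm_funpow[OF N0] mult_perm_1)
  then have "sign (mult_perm N 2) = 1"
    using N by (intro sign_odd_order[OF mult_perm_permutes[OF N0] _ m(1)]) simp_all
  then have "even (h * (h + 1) div 2)"
    unfolding sign_mult_perm_2[OF h] minus_one_power_iff by (simp split: if_splits)
  then have "h mod 4 = 0 \<or> h mod 4 = 3"
    unfolding even_triangular_iff .
  moreover have "N = 8 * (h div 4) + (2 * (h mod 4) + 1)"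
    using h mult_div_mod_eq[of 4 h] by linarith
  ultimately show ?thesis by (elim disjE) (simp_all add: mod_simps)
qed

theorem theorem3p2:
  fixes N :: nat
  assumes "N > 1" and "odd N" and "\<not> 3 dvd N"
  shows "((\<exists>p. prime p \<and> p dvd N \<and> even (ord p 2)) \<longrightarrow>
            det (amusical_adj N) = 0) \<and>
         ((\<forall>p. prime p \<and> p dvd N \<longrightarrow> odd (ord p 2)) \<and>
            (\<exists>r \<in> {1, -1, 5, -5}. [int N = r] (mod 24)) \<longrightarrow>
            det (amusical_adj N) = 3 * 2 ^ amusical_K N) \<and>
         ((\<forall>p. prime p \<and> p dvd N \<longrightarrow> odd (ord p 2)) \<and>
            (\<exists>r \<in> {7, -7, 11, -11}. [int N = r] (mod 24)) \<longrightarrow>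
            det (amusical_adj N) = - 3 * 2 ^ amusical_K N)"
proof -
  note det_adj = det_amusical_adj[OF assms]
  have zero: "det (amusical_adj N) = 0" if "prime p" "p dvd N" "even (ord p 2)" for p
    using det_adj det_one_plus_doubling_eq_0[OF assms(1,2) that, where 'a = rat] by simp
  have int_mod: "int N mod 24 = int (N mod 24)" by (simp add: zmod_int)
  have nonzero: "det (amusical_adj N) = sign (mult_perm N 3) * (3 * 2 ^ amusical_K N) \<and>
      (N mod 8 = 1 \<or> N mod 8 = 7)" if "\<forall>p. prime p \<and> p dvd N \<longrightarrow> odd (ord p 2)"
  proof -
    have "\<exists>m. odd m \<and> [2 ^ m = 1] (mod int N)"
      by (rule exists_odd_exponent) (use assms that in auto)
    then obtain m where m: "odd m" "[2 ^ m = 1] (mod int N)" by blast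
    have "of_int (det (amusical_adj N)) = (of_int (sign (mult_perm N 3) * (3 * 2 ^ amusical_K N)) :: rat)"
      using det_adj det_one_plus_doubling_odd[OF assms(1,2) m, where 'a = rat] by simp
    then show ?thesis
      using odd_order_mod_8[OF assms(1,2) m] by (simp only: of_int_eq_iff)
  qed
  have mod8: "N mod 8 = N mod 24 mod 8" by (simp add: mod_mod_cancel)
  have plus: "N mod 24 = 1 \<or> N mod 24 = 23 \<or> N mod 24 = 5 \<or> N mod 24 = 19"
    if "\<exists>r \<in> {1, -1, 5, -5}. [int N = r] (mod 24)"
    using that by (auto simp: cong_def int_mod)
  have minus: "N mod 24 = 7 \<or> N mod 24 = 17 \<or> N mod 24 = 11 \<or> N mod 24 = 13"
    if "\<exists>r \<in> {7, -7, 11, -11}. [int N = r] (mod 24)"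
    using that by (auto simp: cong_def int_mod)
  show ?thesis
  proof (intro conjI impI)
    assume "\<exists>p. prime p \<and> p dvd N \<and> even (ord p 2)"
    then show "det (amusical_adj N) = 0" using zero by blast
  next
    assume a: "(\<forall>p. prime p \<and> p dvd N \<longrightarrow> odd (ord p 2)) \<and> (\<exists>r \<in> {1, -1, 5, -5}. [int N = r] (mod 24))"
    note nz = nonzero[OF conjunct1[OF a]]
    \<comment> \<open>The residues 5 and 19 are 5 and 3 modulo 8, impossible when all orders are
      odd.\<close>
    have "N mod 24 = 1 \<or> N mod 24 = 23"
      using plus[OF conjunct2[OF a]] conjunct2[OF nz] unfolding mod8 by (elim disjE) simp_all
    then have "sign (mult_perm N 3) = 1"
      using sign_mult_perm_3_mod_24(1,2)[of N] by blast
    then show "det (amusical_adj N) = 3 * 2 ^ amusical_K N"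
      using conjunct1[OF nz] by simp
  next
    assume a: "(\<forall>p. prime p \<and> p dvd N \<longrightarrow> odd (ord p 2)) \<and> (\<exists>r \<in> {7, -7, 11, -11}. [int N = r] (mod 24))"
    note nz = nonzero[OF conjunct1[OF a]]
    \<comment> \<open>Likewise 11 and 13 are 3 and 5 modulo 8.\<close>
    have "N mod 24 = 7 \<or> N mod 24 = 17"
      using minus[OF conjunct2[OF a]] conjunct2[OF nz] unfolding mod8 by (elim disjE) simp_all
    then have "sign (mult_perm N 3) = - 1"
      using sign_mult_perm_3_mod_24(3,4)[of N] by blast
    then show "det (amusical_adj N) = - 3 * 2 ^ amusical_K N"
      using conjunct1[OF nz] by simp
  qed
qed

end
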